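(* Let $n\ge 2$ be an integer and let $f(x)$ be a complex polynomial of degree $n$. Suppose that there exists a nonzero complex polynomial $p(x)$ of degree $\le n-2$ such that $f''(x)p(x)-f'(x)p'(x)$ is divisible by $f(x)$. Then: (i) $n\ge 4$ and $\deg(p)\ge 2$. (ii) There exists a quadratic polynomial $\tilde p(x)$ (i.e., a complex polynomial of degree $2$) such that $f(x)$ is divisible by $\tilde p(x)^2$. In particular, $f(x)$ has a multiple root. (iii) If $\deg(p)=2$, then $p(x)$ divides both $f(x)$ and $f'(x)$; in particular, all the roots of $p(x)$ are multiple roots of $f(x)$. (iv) If $n=4$, then $\deg(p)=2$ and there exists a nonzero complex number $c$ such that $f(x)=c\cdot p(x)^2$.
   Context: All polynomials are in $\mathbb{C}[x]$, divisibility is in $\mathbb{C}[x]$, and $'$ denotes the derivative with respect to $x$. *)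

theory Defs
  imports Complex_Main "HOL-Computational_Algebra.Polynomial"
begin

end

theory Submission
  imports
    Defs
    "HOL-Computational_Algebra.Fundamental_Theorem_Algebra"
    "HOL-Computational_Algebra.Field_as_Ring"
    "HOL-Computational_Algebra.Polynomial_Factorial"
begin

text \<open>
  Write \<open>W = f'' p - f' p'\<close>, the Wronskian of \<open>p\<close> and \<open>f'\<close>. As \<open>deg p < deg f'\<close>, it is nonzero; its
  degree is at most \<open>deg p + n - 2\<close>, and \<open>f dvd W\<close> forces it to be at least \<open>n\<close>. Hence
  \<open>deg p \<ge> 2\<close> and \<open>n \<ge> 4\<close>.

  A local computation at a root \<open>a\<close> of \<open>f\<close> shows that \<open>p\<close> vanishes at \<open>a\<close> if \<open>a\<close> is a multiple
  root, and vanishes twice if the multiplicity is at least \<open>3\<close>. Hence \<open>q dvd p\<close> for each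
  quadratic \<open>q\<close> with \<open>q\<^sup>2 dvd f\<close> (\<open>quadratic_dvd_if_square_dvd\<close>). Once such a \<open>q\<close> exists,
  \<open>deg p = 2\<close> makes \<open>p\<close> a scalar multiple of \<open>q\<close>, so that \<open>p\<^sup>2 dvd f\<close>; the remaining claims follow.

  To see that \<open>q\<close> exists, suppose otherwise and let \<open>b\<close> be a root of \<open>f\<close> of largest multiplicity
  \<open>r\<close>. Then \<open>r \<le> 3\<close>, all other roots are simple, and the local computation gives
  \<open>(x - b)\<^bsup>r-1\<^esup> dvd p\<close>. This is impossible
  (\<open>not_root_power_dvd_of_one_multiple_root\<close>): \<open>f dvd W\<close> says that
  \<open>p/f\<^sup>2\<close> has residue zero at every simple root of \<open>f\<close>, hence also at \<open>b\<close>, as the residues sum to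
  zero by \<open>deg p \<le> n - 2\<close>. The pole of \<open>p/f\<^sup>2\<close> at \<open>b\<close> has order at most \<open>2r - (r - 1) = r + 1\<close>, so
  \<open>p/f\<^sup>2\<close> is the derivative of some \<open>q/f\<close> with \<open>deg q < n\<close>, that is \<open>p = q' f - q f'\<close>; but this
  Wronskian has degree at least \<open>n - 1\<close>. The formal proof replaces the residues by a Bezout argument modulo the radical of \<open>f\<close> and a comparison of degrees.
\<close>

section \<open>The degree of a Wronskian\<close>

lemma coeff_mult_pCons_pderiv:
  fixes f q :: "'a::{idom,semiring_char_0} poly"
  shows "coeff (f * pCons 0 (pderiv q)) (degree f + degree q) =
    of_nat (degree q) * lead_coeff f * lead_coeff q"
proof (cases "degree q = 0")
  case True
  then have "pderiv q = 0" by (simp add: pderiv_eq_0_iff)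
  with True show ?thesis by simp
next
  case False
  then have nz: "pderiv q \<noteq> 0" by (simp add: pderiv_eq_0_iff)
  have deg: "degree (pCons 0 (pderiv q)) = degree q"
    using nz False by (simp add: degree_pCons_eq degree_pderiv)
  have lc: "coeff (pCons 0 (pderiv q)) (degree q) = of_nat (degree q) * lead_coeff q"
    using False by (cases "degree q") (simp_all add: coeff_pderiv)
  show ?thesis
    using coeff_mult_degree_sum[of f "pCons 0 (pderiv q)"] unfolding deg lc
    by (simp add: algebra_simps)
qed

lemma degree_wronskian_ge:
  fixes f q :: "'a::{idom,ring_char_0} poly"
  assumes "f \<noteq> 0" "q \<noteq> 0" "degree q < degree f"
  shows "f * pderiv q - q * pderiv f \<noteq> 0"
    and "degree f + degree q \<le> Suc (degree (f * pderiv q - q * pderiv f))"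
proof -
  let ?W = "f * pderiv q - q * pderiv f"
  \<comment> \<open>Multiplication by the variable turns each derivative of degree \<open>d - 1\<close> into one of degree \<open>d\<close>.\<close>
  have eq: "pCons 0 ?W = f * pCons 0 (pderiv q) - q * pCons 0 (pderiv f)"
    by simp
  have "coeff (pCons 0 ?W) (degree f + degree q) =
      coeff (f * pCons 0 (pderiv q)) (degree f + degree q) -
      coeff (q * pCons 0 (pderiv f)) (degree f + degree q)"
    unfolding eq by (rule coeff_diff)
  also have "\<dots> = (of_nat (degree q) - of_nat (degree f)) * (lead_coeff f * lead_coeff q)"
    unfolding coeff_mult_pCons_pderiv
      coeff_mult_pCons_pderiv[of q f, unfolded add.commute[of "degree q"]]
    by (simp add: algebra_simps)
  also have "\<dots> \<noteq> 0" using assms by simp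
  finally have c: "coeff (pCons 0 ?W) (degree f + degree q) \<noteq> 0" .
  then show nz: "?W \<noteq> 0" by auto
  show "degree f + degree q \<le> Suc (degree ?W)"
    using le_degree[OF c] nz by (simp add: degree_pCons_eq)
qed

section \<open>Behaviour at a multiple root\<close>

lemma pderiv_root_power_mult:
  fixes w :: "'a::{idom,ring_char_0} poly"
  shows "pderiv ([:-a, 1:] ^ Suc j * w) =
    [:-a, 1:] ^ j * (smult (of_nat (Suc j)) w + [:-a, 1:] * pderiv w)"
proof -
  define l where "l = [:-a, 1:]"
  have "pderiv l = 1" by (simp add: l_def pderiv_pCons)
  then have "pderiv (l ^ Suc j * w) = l ^ j * (smult (of_nat (Suc j)) w + l * pderiv w)"
    unfolding pderiv_mult pderiv_power_Suc
    by (simp add: algebra_simps del: of_nat_Suc)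
  then show ?thesis unfolding l_def .
qed

text \<open>If \<open>a\<close> has multiplicity \<open>r \<ge> 2\<close> in \<open>f\<close> and \<open>s\<close> in \<open>p\<close>, then the term of order \<open>r + s - 2\<close>
  at \<open>a\<close> in \<open>f'' p - f' p'\<close> has coefficient proportional to \<open>r (r - 1 - s)\<close>. As \<open>(x - a)\<^sup>r\<close>
  divides this polynomial, \<open>s \<ge> 2\<close> or \<open>s = r - 1\<close>.\<close>

lemma multiple_root_imp_root:
  fixes f p :: "'a::field_char_0 poly"
  assumes "f \<noteq> 0" and dvd: "f dvd (pderiv (pderiv f) * p - pderiv f * pderiv p)"
    and r: "order a f \<ge> 2"
  shows "[:-a, 1:] dvd p" and "order a f \<ge> 3 \<Longrightarrow> [:-a, 1:] ^ 2 dvd p"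
proof -
  define l where "l = [:-a, 1:]"
  have l0: "l \<noteq> 0" and la: "poly l a = 0" and l': "pderiv l = 1"
    by (simp_all add: l_def pderiv_pCons)
  obtain k where k: "order a f = Suc (Suc k)"
    using r by (metis Suc_le_D numeral_2_eq_2 Suc_le_mono)
  obtain h where f: "f = l ^ Suc (Suc k) * h" and h: "\<not> l dvd h"
    using order_decomp[OF \<open>f \<noteq> 0\<close>, of a] k unfolding l_def by metis
  have ha: "poly h a \<noteq> 0" using h by (simp add: l_def poly_eq_0_iff_dvd)
  define B where "B = smult (of_nat (Suc (Suc k))) h + l * pderiv h"
  define A where "A = smult (of_nat (Suc k)) B + l * pderiv B"
  have f': "pderiv f = l ^ Suc k * B"
    unfolding f B_def l_def by (rule pderiv_root_power_mult)
  have f'': "pderiv (pderiv f) = l ^ k * A"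
    unfolding f' A_def l_def by (rule pderiv_root_power_mult)
  have Ba: "poly B a \<noteq> 0"
    using ha la by (simp add: B_def del: of_nat_Suc)
  have Aa: "poly A a = of_nat (Suc k) * poly B a"
    using la by (simp add: A_def)
  have "l ^ k * (l ^ 2 * h) dvd l ^ k * (A * p - l * B * pderiv p)"
    using dvd unfolding f'' unfolding f' by (simp add: f power2_eq_square algebra_simps)
  then have "l ^ 2 * h dvd A * p - l * B * pderiv p"
    using l0 by simp
  then have d2: "l ^ 2 dvd A * p - l * B * pderiv p"
    by (rule dvd_mult_left)
  then have "l dvd A * p - l * B * pderiv p"
    by (metis dvd_mult_left power2_eq_square)
  then have "poly (A * p - l * B * pderiv p) a = 0"
    by (simp only: l_def poly_eq_0_iff_dvd)
  then have "poly p a = 0"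
    using Aa Ba la by (simp del: of_nat_Suc)
  then show *: "[:-a, 1:] dvd p" by (simp add: poly_eq_0_iff_dvd)
  assume "order a f \<ge> 3"
  then have k0: "k \<noteq> 0" using k by simp
  obtain P where p: "p = l * P" using * unfolding l_def by (elim dvdE)
  have p': "pderiv p = P + l * pderiv P"
    by (simp add: p pderiv_mult l' algebra_simps)
  have "A * p - l * B * pderiv p = l * (A * P - B * (P + l * pderiv P))"
    unfolding p' by (simp add: p algebra_simps)
  then have "l * l dvd l * (A * P - B * (P + l * pderiv P))"
    using d2 by (simp add: power2_eq_square)
  then have "l dvd A * P - B * (P + l * pderiv P)"
    using l0 by simp
  then have "poly (A * P - B * (P + l * pderiv P)) a = 0"
    by (simp only: l_def poly_eq_0_iff_dvd)
  then have "of_nat k * poly B a * poly P a = 0"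
    using Aa la by (simp add: algebra_simps)
  then have "poly P a = 0" using k0 Ba by simp
  then have "l dvd P" by (simp add: l_def poly_eq_0_iff_dvd)
  then show "[:-a, 1:] ^ 2 dvd p"
    unfolding p l_def power2_eq_square by (rule mult_dvd_mono[OF dvd_refl])
qed

section \<open>Squares of quadratic polynomials dividing f\<close>

lemma root_factors_mult_dvd:
  fixes a b :: "'a::field_char_0"
  assumes "a \<noteq> b" "[:-a, 1:] dvd p" "[:-b, 1:] dvd p"
  shows "[:-a, 1:] * [:-b, 1:] dvd p"
proof -
  obtain P where p: "p = [:-a, 1:] * P" using assms(2) by (elim dvdE)
  have "poly p b = 0" using assms(3) by (simp add: poly_eq_0_iff_dvd)
  then have "poly P b = 0" using assms(1) unfolding p by simp
  then have "[:-b, 1:] dvd P" by (simp add: poly_eq_0_iff_dvd)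
  then show ?thesis unfolding p by (rule mult_dvd_mono[OF dvd_refl])
qed

lemma complex_quadratic_splits:
  fixes q :: "complex poly"
  assumes "degree q = 2"
  obtains c a b where "c \<noteq> 0" "q = smult c ([:-a, 1:] * [:-b, 1:])"
proof -
  have "q \<noteq> 0" using assms by auto
  obtain a where "poly q a = 0"
    using alg_closed_imp_poly_has_root[of q] assms by auto
  then obtain q1 where q: "q = [:-a, 1:] * q1"
    unfolding poly_eq_0_iff_dvd by (elim dvdE)
  have "q1 \<noteq> 0" using q \<open>q \<noteq> 0\<close> by auto
  then have d1: "degree q1 = 1"
    using assms unfolding q by (subst (asm) degree_mult_eq) auto
  obtain b where "poly q1 b = 0"
    using alg_closed_imp_poly_has_root[of q1] d1 by auto
  then obtain q2 where q1: "q1 = [:-b, 1:] * q2"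
    unfolding poly_eq_0_iff_dvd by (elim dvdE)
  have "q2 \<noteq> 0" using q1 \<open>q1 \<noteq> 0\<close> by auto
  then have "degree q2 = 0"
    using d1 unfolding q1 by (subst (asm) degree_mult_eq) auto
  then obtain c where c: "q2 = [:c:]" by (rule degree_eq_zeroE)
  have "q = smult c ([:-a, 1:] * [:-b, 1:])"
    unfolding q q1 c by (simp add: algebra_simps)
  moreover have "c \<noteq> 0" using c \<open>q2 \<noteq> 0\<close> by auto
  ultimately show ?thesis by (rule that[rotated])
qed

lemma order_ge_2_if_root_square_dvd:
  fixes f q :: "'a::field_char_0 poly"
  assumes "f \<noteq> 0" "q ^ 2 dvd f" "poly q a = 0"
  shows "order a f \<ge> 2"
proof -
  have "[:-a, 1:] ^ 2 dvd q ^ 2"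
    using assms(3) by (intro dvd_power_same) (simp add: poly_eq_0_iff_dvd)
  then have "[:-a, 1:] ^ 2 dvd f" using assms(2) by (rule dvd_trans)
  then show ?thesis using assms(1) by (simp add: order_divides)
qed

lemma quadratic_dvd_if_square_dvd:
  fixes f p q :: "complex poly"
  assumes f0: "f \<noteq> 0" and dvd: "f dvd (pderiv (pderiv f) * p - pderiv f * pderiv p)"
    and q: "degree q = 2" "q ^ 2 dvd f"
  shows "q dvd p"
proof -
  obtain c a b where c: "c \<noteq> 0" and qe: "q = smult c ([:-a, 1:] * [:-b, 1:])"
    using complex_quadratic_splits[OF q(1)] .
  have "poly q x = c * ((x - a) * (x - b))" for x
    by (simp add: qe algebra_simps)
  then have a2: "order a f \<ge> 2" and b2: "order b f \<ge> 2"
    using order_ge_2_if_root_square_dvd[OF f0 q(2)] by simp_all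
  have "[:-a, 1:] * [:-b, 1:] dvd p"
  proof (cases "a = b")
    case False
    then show ?thesis
      using root_factors_mult_dvd multiple_root_imp_root(1)[OF f0 dvd] a2 b2 by blast
  next
    case True
    have "([:-a, 1:] ^ 2) ^ 2 dvd q ^ 2"
      using True by (intro dvd_power_same)
        (simp add: qe power2_eq_square dvd_smult del: mult_pCons_left mult_pCons_right)
    then have "[:-a, 1:] ^ 4 dvd f" using q(2) dvd_trans by (simp flip: power_mult)
    then have "order a f \<ge> 4" using f0 by (simp add: order_divides)
    then have "[:-a, 1:] ^ 2 dvd p"
      using multiple_root_imp_root(2)[OF f0 dvd a2] by simp
    then show ?thesis using True by (simp only: power2_eq_square)
  qed
  then show ?thesis unfolding qe using c by (intro smult_dvd)
qed

section \<open>Polynomials with at most one multiple root\<close>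

lemma coprime_if_no_common_root:
  fixes u v :: "complex poly"
  assumes "v \<noteq> 0" "\<And>x. poly v x = 0 \<Longrightarrow> poly u x \<noteq> 0"
  shows "coprime u v"
proof (rule coprimeI)
  fix d assume d: "d dvd u" "d dvd v"
  then have "d \<noteq> 0" using assms(1) by auto
  have "degree d = 0"
  proof (rule ccontr)
    assume "degree d \<noteq> 0"
    then obtain x where "poly d x = 0"
      using alg_closed_imp_poly_has_root[of d] by auto
    then have "poly u x = 0" "poly v x = 0"
      using d by (auto elim!: dvdE)
    then show False using assms(2) by blast
  qed
  then show "is_unit d" using \<open>d \<noteq> 0\<close> by (simp add: is_unit_iff_degree)
qed

text \<open>Suppose \<open>(x - b)\<^sup>j dvd p\<close>. All of \<open>f\<close>, \<open>f'\<close> and \<open>p\<close> are then multiples of \<open>(x - b)\<^sup>j\<close>, and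
  \<open>F = (x - b) F1\<close> is the radical of \<open>f\<close>. In the proof, \<open>q\<close> solves \<open>q f' + p = f k\<close>; the
  divisibility by \<open>f\<close> gives \<open>q' = k\<close> modulo \<open>F1\<close>, and the bounds on the degrees make this an
  equality, that is \<open>p/f\<^sup>2 = (q/f)'\<close>.\<close>

lemma not_root_power_dvd_of_one_multiple_root:
  fixes f p F1 :: "complex poly"
  assumes f: "f = [:-b, 1:] ^ Suc j * F1"
    and sqf: "rsquarefree F1" and F1b: "poly F1 b \<noteq> 0"
    and p0: "p \<noteq> 0" and degp: "degree p + 2 \<le> degree f"
    and dvd: "f dvd (pderiv (pderiv f) * p - pderiv f * pderiv p)"
  shows "\<not> [:-b, 1:] ^ j dvd p"
proof
  define l where "l = [:-b, 1:]"
  have l0: "l \<noteq> 0" and lx: "\<And>x. poly l x = x - b" and l': "pderiv l = 1" and dl: "degree l = 1"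
    by (simp_all add: l_def pderiv_pCons)
  assume "[:-b, 1:] ^ j dvd p"
  then obtain P where p: "p = l ^ j * P" unfolding l_def by (elim dvdE)
  have F10: "F1 \<noteq> 0" using F1b by auto
  have P0: "P \<noteq> 0" using p p0 by auto
  define F where "F = l * F1"
  define G where "G = smult (of_nat (Suc j)) F1 + l * pderiv F1"
  have fF: "f = l ^ j * F" by (simp add: f F_def l_def algebra_simps)
  have f': "pderiv f = l ^ j * G"
    unfolding f G_def l_def by (rule pderiv_root_power_mult)
  have F0: "F \<noteq> 0" using l0 F10 by (simp add: F_def)
  have f0: "f \<noteq> 0" using fF l0 F0 by simp
  have degF: "degree F = Suc (degree F1)"
    using l0 F10 dl by (simp add: F_def degree_mult_eq)
  have degf: "degree f = j + Suc (degree F1)"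
    using l0 F0 dl degF by (simp add: fF degree_mult_eq degree_power_eq)
  have "degree p = j + degree P"
    using l0 P0 dl by (simp add: p degree_mult_eq degree_power_eq)
  then have degP: "degree P < degree F1" using degp degf by simp

  have simple: "poly (pderiv F1) x \<noteq> 0" if "poly F1 x = 0" for x
    using sqf that rsquarefree_roots by blast
  have Gx: "poly G x \<noteq> 0" if "poly F1 x = 0" for x
  proof -
    have "x \<noteq> b" using that F1b by auto
    then show ?thesis using simple[OF that] that by (simp add: G_def lx)
  qed
  have Gb: "poly G b \<noteq> 0" using F1b by (simp add: G_def lx del: of_nat_Suc)
  have "coprime G F"
    using F0 Gx Gb by (intro coprime_if_no_common_root) (auto simp: F_def lx)
  have "coprime (pderiv f) F1"
    using F10 Gx F1b by (intro coprime_if_no_common_root) (auto simp: f' lx)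

  obtain u v where uv: "u * G + v * F = 1"
    using \<open>coprime G F\<close> by (metis bezout_coefficients_fst_snd coprime_imp_gcd_eq_1)
  \<comment> \<open>\<open>u\<close> inverts \<open>G\<close> modulo \<open>F\<close>, so \<open>q\<close> is the reduced solution of \<open>q G + P = 0\<close> modulo \<open>F\<close>.\<close>
  define q where "q = (- (P * u)) mod F"
  have degq: "degree q \<le> degree F1"
    using degree_mod_less[OF F0, of "- (P * u)"] degF unfolding q_def by auto
  have "F dvd q * G + P"
  proof -
    have "q * G + P = - (P * u) * G + P - F * ((- (P * u)) div F) * G"
      unfolding q_def by (simp add: minus_mult_div_eq_mod[symmetric] algebra_simps)
    also have "- (P * u) * G + P = P * (1 - u * G)" by (simp add: algebra_simps)
    also have "1 - u * G = F * v" using uv by (simp add: algebra_simps)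
    finally have "q * G + P = F * (P * v - ((- (P * u)) div F) * G)"
      by (simp add: algebra_simps)
    then show ?thesis by simp
  qed
  then obtain k where k: "q * G + P = F * k" by (elim dvdE)
  then have qk: "q * pderiv f + p = f * k"
  proof -
    have "q * pderiv f + p = l ^ j * (q * G + P)"
      unfolding f' p by (simp add: algebra_simps)
    then show ?thesis unfolding k fF by (simp add: algebra_simps)
  qed

  have degG: "degree G \<le> degree F1"
  proof (cases "degree F1 = 0")
    case True
    then have "pderiv F1 = 0" by (simp add: pderiv_eq_0_iff)
    then show ?thesis by (simp add: G_def)
  next
    case False
    have "degree (l * pderiv F1) \<le> degree F1"
      using degree_mult_le[of l "pderiv F1"] dl False by (simp add: degree_pderiv)
    then show ?thesis unfolding G_def by (intro degree_add_le) auto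
  qed
  have degk: "degree k < degree F1"
  proof (cases "k = 0")
    case True
    then show ?thesis using degP by simp
  next
    case False
    have "degree (q * G + P) \<le> degree F1 + degree F1"
      using degree_mult_le[of q G] degq degG degP by (intro degree_add_le) auto
    moreover have "degree (F * k) = Suc (degree F1) + degree k"
      using F0 False degF by (simp add: degree_mult_eq)
    ultimately show ?thesis using k by simp
  qed

  \<comment> \<open>Differentiate \<open>q f' + p = f k\<close>, multiply by \<open>f'\<close> and replace \<open>q f'\<close> by \<open>f k - p\<close>: modulo \<open>f\<close>,
    what remains is \<open>f'\<^sup>2 (q' - k) = f'' p - f' p' = 0\<close>.\<close>
  have "F1 dvd pderiv q - k"
  proof -
    have D: "pderiv q * pderiv f + q * pderiv (pderiv f) + pderiv p = f * pderiv k + k * pderiv f"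
      using arg_cong[OF qk, of pderiv] by (simp add: pderiv_add pderiv_mult algebra_simps)
    have q': "q * pderiv f = f * k - p" using qk by (simp add: algebra_simps)
    have "pderiv f * (pderiv f * (pderiv q - k)) =
        pderiv f * (pderiv q * pderiv f + q * pderiv (pderiv f) + pderiv p)
        - (q * pderiv f) * pderiv (pderiv f) - pderiv f * pderiv p - k * pderiv f * pderiv f"
      by (simp add: algebra_simps)
    also have "\<dots> = f * (pderiv f * pderiv k - k * pderiv (pderiv f)) +
        (pderiv (pderiv f) * p - pderiv f * pderiv p)"
      unfolding D q' by (simp add: algebra_simps)
    also have "f dvd \<dots>" using dvd by (intro dvd_add) auto
    finally have "F1 dvd pderiv f * (pderiv f * (pderiv q - k))"
      using f by (meson dvd_mult_right)
    then show ?thesis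
      using \<open>coprime (pderiv f) F1\<close> by (simp add: coprime_dvd_mult_right_iff coprime_commute)
  qed
  moreover have "degree (pderiv q - k) < degree F1"
    using degk degq by (intro degree_diff_less) (auto simp: degree_pderiv)
  ultimately have "pderiv q = k"
    by (metis dvd_imp_degree_le leD right_minus_eq)
  then have W: "p = f * pderiv q - q * pderiv f"
    using qk by (simp add: algebra_simps)
  then have "q \<noteq> 0" using p0 by auto
  then have "degree f + degree q \<le> Suc (degree p)"
    using degree_wronskian_ge(2)[OF f0, of q] degq degf W by simp
  then show False using degp by simp
qed

text \<open>The base point \<open>b\<close> is a root of largest multiplicity; without a quadratic square dividing
  \<open>f\<close>, every other root is simple.\<close>

lemma exists_quadratic_square_dvd:
  fixes f p :: "complex poly"
  assumes p0: "p \<noteq> 0" and degp: "degree p + 2 \<le> degree f"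
    and dvd: "f dvd (pderiv (pderiv f) * p - pderiv f * pderiv p)"
  shows "\<exists>q :: complex poly. degree q = 2 \<and> q ^ 2 dvd f"
proof (rule ccontr)
  assume none: "\<not> ?thesis"
  have f0: "f \<noteq> 0" using degp by auto
  obtain z where z: "poly f z = 0"
    using alg_closed_imp_poly_has_root[of f] degp by auto
  obtain b where b: "\<And>x. order x f \<le> order b f"
  proof -
    define M where "M = Max (range (\<lambda>x. order x f))"
    have fin: "finite (range (\<lambda>x. order x f))"
      by (rule finite_subset[of _ "{..degree f}"]) (use order_degree[OF f0] in auto)
    then have "M \<in> range (\<lambda>x. order x f)" unfolding M_def by (intro Max_in) auto
    then obtain b where "M = order b f" by auto
    then show ?thesis using that Max_ge[OF fin] unfolding M_def by auto
  qed
  have "order b f \<noteq> 0"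
    using b[of z] z f0 by (metis le_zero_eq order_root)
  then obtain j where j: "order b f = Suc j" by (cases "order b f") auto
  obtain F1 where f: "f = [:-b, 1:] ^ Suc j * F1" and F1: "\<not> [:-b, 1:] dvd F1"
    using order_decomp[OF f0, of b] j by metis
  have F1b: "poly F1 b \<noteq> 0" using F1 by (simp add: poly_eq_0_iff_dvd)
  have F10: "F1 \<noteq> 0" using f f0 by auto
  have "order b f < 4"
  proof (rule ccontr)
    assume "\<not> order b f < 4"
    then have "[:-b, 1:] ^ 4 dvd f" by (simp add: order_divides)
    then have "([:-b, 1:] ^ 2) ^ 2 dvd f" by (simp flip: power_mult)
    moreover have "degree ([:-b, 1:] ^ 2) = 2" by (simp add: degree_power_eq)
    ultimately show False using none by blast
  qed
  then have "j \<le> 2" using j by simp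
  have "[:-b, 1:] ^ j dvd p"
  proof -
    consider "j = 0" | "j = 1" | "j = 2" using \<open>j \<le> 2\<close> by linarith
    then show ?thesis
      using multiple_root_imp_root[OF f0 dvd, of b] j by cases auto
  qed
  moreover have "rsquarefree F1"
    unfolding rsquarefree_def
  proof (intro conjI allI F10)
    fix a
    show "order a F1 = 0 \<or> order a F1 = 1"
    proof (rule ccontr)
      assume neg: "\<not> (order a F1 = 0 \<or> order a F1 = 1)"
      then have "poly F1 a = 0" using order_0I by blast
      then have "a \<noteq> b" using F1b by auto
      have "order a F1 \<le> order a f"
        using f f0 order_mult by (metis le_add2)
      then have "order a f \<ge> 2" "order b f \<ge> 2" using neg b[of a] by auto
      then have "[:-a, 1:] ^ 2 dvd f" "[:-b, 1:] ^ 2 dvd f"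
        by (simp_all add: order_divides)
      moreover have "coprime ([:-a, 1:] ^ 2) ([:-b, 1:] ^ 2)"
        using \<open>a \<noteq> b\<close> by (intro coprime_if_no_common_root) auto
      ultimately have "([:-a, 1:] * [:-b, 1:]) ^ 2 dvd f"
        unfolding power_mult_distrib by (rule divides_mult)
      moreover have "degree ([:-a, 1:] * [:-b, 1:]) = 2"
        by (simp add: degree_mult_eq)
      ultimately show False using none by blast
    qed
  qed
  ultimately show False
    using not_root_power_dvd_of_one_multiple_root[OF f _ F1b p0 degp dvd] by blast
qed

section \<open>The theorem\<close>

theorem theorem1p5:
  fixes n :: nat and f p :: "complex poly"
  assumes "n \<ge> 2"
    and "degree f = n"
    and "p \<noteq> 0"
    and "degree p \<le> n - 2"
    and "f dvd (pderiv (pderiv f) * p - pderiv f * pderiv p)"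
  shows "(n \<ge> 4 \<and> degree p \<ge> 2) \<and>
    ((\<exists>q :: complex poly. degree q = 2 \<and> q ^ 2 dvd f) \<and> (\<exists>a. order a f \<ge> 2)) \<and>
    (degree p = 2 \<longrightarrow>
       p dvd f \<and> p dvd pderiv f \<and> (\<forall>a. poly p a = 0 \<longrightarrow> order a f \<ge> 2)) \<and>
    (n = 4 \<longrightarrow> degree p = 2 \<and> (\<exists>c. c \<noteq> 0 \<and> f = smult c (p ^ 2)))"
proof -
  have f0: "f \<noteq> 0" using assms(1,2) by auto
  have degp: "degree p + 2 \<le> degree f" using assms by simp
  let ?W = "p * pderiv (pderiv f) - pderiv f * pderiv p"
  have fW: "f dvd ?W" using assms(5) by (simp add: mult.commute)
  have df': "degree (pderiv f) = n - 1" using assms(2) by (simp add: degree_pderiv)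
  have f'0: "pderiv f \<noteq> 0" using assms(1,2) by (simp add: pderiv_eq_0_iff)
  have "degree p < degree (pderiv f)" using df' assms(1,4) by simp
  from degree_wronskian_ge(1)[OF f'0 assms(3) this] have W0: "?W \<noteq> 0" by auto
  \<comment> \<open>For constant \<open>p\<close> the truncated \<open>deg p - 1\<close> would spoil the bound, but then \<open>p' = 0\<close>.\<close>
  have "degree ?W + 2 \<le> n + degree p"
  proof (cases "degree p = 0")
    case True
    then have "pderiv p = 0" by (simp add: pderiv_eq_0_iff)
    then show ?thesis
      using degree_mult_le[of p "pderiv (pderiv f)"] assms(1,2) by (simp add: degree_pderiv)
  next
    case False
    have "degree ?W \<le> n + degree p - 2"
    proof (rule degree_diff_le)
      show "degree (p * pderiv (pderiv f)) \<le> n + degree p - 2"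
        using degree_mult_le[of p "pderiv (pderiv f)"] assms(1,2) by (simp add: degree_pderiv)
      show "degree (pderiv f * pderiv p) \<le> n + degree p - 2"
        using degree_mult_le[of "pderiv f" "pderiv p"] assms(1,2) False by (simp add: degree_pderiv)
    qed
    then show ?thesis using assms(1) by simp
  qed
  moreover have "n \<le> degree ?W"
    using dvd_imp_degree_le[OF fW W0] assms(2) by simp
  ultimately have p2: "degree p \<ge> 2" by simp
  then have n4: "n \<ge> 4" using assms(1,4) by simp

  obtain q :: "complex poly" where q: "degree q = 2" "q ^ 2 dvd f"
    using exists_quadratic_square_dvd[OF assms(3) degp assms(5)] by blast
  obtain z where "poly q z = 0"
    using alg_closed_imp_poly_has_root[of q] q(1) by auto
  then have mult: "order z f \<ge> 2"
    by (rule order_ge_2_if_root_square_dvd[OF f0 q(2)])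

  have psq: "p ^ 2 dvd f" if d: "degree p = 2"
  proof -
    obtain s where s: "p = q * s"
      using quadratic_dvd_if_square_dvd[OF f0 assms(5) q] by (elim dvdE)
    then have s0: "s \<noteq> 0" "q \<noteq> 0" using assms(3) by auto
    then have "degree s = 0" using d q(1) unfolding s by (simp add: degree_mult_eq)
    then have "is_unit s" using s0 by (simp add: is_unit_iff_degree)
    then have "p dvd q" unfolding s by simp
    then have "p ^ 2 dvd q ^ 2" by (rule dvd_power_same)
    then show ?thesis using q(2) by (rule dvd_trans)
  qed
  have three: "p dvd f \<and> p dvd pderiv f \<and> (\<forall>a. poly p a = 0 \<longrightarrow> order a f \<ge> 2)"
    if d: "degree p = 2"
  proof -
    obtain h where h: "f = p ^ 2 * h" using psq[OF d] by (elim dvdE)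
    have "pderiv f = p * (p * pderiv h + 2 * pderiv p * h)"
      by (simp add: h power2_eq_square pderiv_mult algebra_simps)
    moreover have "f = p * (p * h)" by (simp add: h power2_eq_square)
    ultimately show ?thesis
      using order_ge_2_if_root_square_dvd[OF f0 psq[OF d]] by (metis dvd_triv_left)
  qed
  have four: "degree p = 2 \<and> (\<exists>c. c \<noteq> 0 \<and> f = smult c (p ^ 2))" if "n = 4"
  proof -
    have d: "degree p = 2" using that p2 assms(4) by simp
    obtain h where h: "f = p ^ 2 * h" using psq[OF d] by (elim dvdE)
    then have h0: "h \<noteq> 0" using f0 by auto
    have "4 = 4 + degree h"
      using assms(2,3) that d h0 by (simp add: h degree_mult_eq degree_power_eq)
    then obtain c where "h = [:c:]" using degree_eq_zeroE[of h] by auto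
    then have "c \<noteq> 0" "f = smult c (p ^ 2)" using h h0 by auto
    then show ?thesis using d by blast
  qed
  show ?thesis using n4 p2 q mult three four by blast
qed

end
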